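(* Let $k>1$ be an integer and $\sigma$ a permutation of $\{0,1,2,3\}$. Every symmetric $4$-digit $(\sigma,k)$-permutiple $[a_0;a_1,a_2,a_3]$ is continuant-preserving, i.e. $K_4(a_0,a_1,a_2,a_3)=K_4(a_{\sigma(0)},a_{\sigma(1)},a_{\sigma(2)},a_{\sigma(3)})$.
   Context: For positive integers $a_0,\ldots,a_n$, $[a_0;a_1,\ldots,a_n]$ denotes the finite simple continued fraction $a_0+1/(a_1+1/(\cdots+1/a_n))$; all finite continued fractions are assumed in canonical form (last digit at least $2$ when there are at least two digits). For an integer $k>1$ and a permutation $\sigma$ of $\{0,\ldots,n\}$, $r=[a_0;\ldots,a_n]$ is a $(\sigma,k)$-permutiple if $r=k\,[a_{\sigma(0)};a_{\sigma(1)},\ldots,a_{\sigma(n)}]$. It is symmetric if $a_ja_{n-j}=a_{\sigma(j)}a_{\sigma(n-j)}$ for all $0\le j\le n$. Continuants: $K_0()=1$, $K_1(x_0)=x_0$, $K_m(x_0,\ldots,x_{m-1})=x_{m-1}K_{m-1}(x_0,\ldots,x_{m-2})+K_{m-2}(x_0,\ldots,x_{m-3})$. *)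

theory Defs
  imports Complex_Main "HOL-Combinatorics.Permutations"
begin

text \<open>A tuple of digits \<open>a\<^sub>0, \<dots>, a\<^sub>n\<close> is represented by a function on the naturals together with
  the last index \<open>n\<close>; values beyond \<open>n\<close> are irrelevant to all notions below.\<close>

primrec cfrac :: "(nat \<Rightarrow> nat) \<Rightarrow> nat \<Rightarrow> real" where
  "cfrac a 0 = real (a 0)"
| "cfrac a (Suc n) = real (a 0) + 1 / cfrac (\<lambda>i. a (Suc i)) n"

definition canonical_digits :: "(nat \<Rightarrow> nat) \<Rightarrow> nat \<Rightarrow> bool" where
  "canonical_digits a n \<longleftrightarrow> (\<forall>i\<le>n. 0 < a i) \<and> (1 \<le> n \<longrightarrow> 2 \<le> a n)"

text \<open>The first argument of the continuant is the number of entries: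
  \<open>continuant m x\<close> is the continuant of \<open>x\<^sub>0, \<dots>, x\<^sub>m\<^sub>-\<^sub>1\<close>.\<close>

fun continuant :: "nat \<Rightarrow> (nat \<Rightarrow> nat) \<Rightarrow> nat" where
  "continuant 0 x = 1"
| "continuant (Suc 0) x = x 0"
| "continuant (Suc (Suc m)) x = x (Suc m) * continuant (Suc m) x + continuant m x"

text \<open>Both continued fractions, the original and the permuted one, are required to be in
  canonical form.\<close>

definition permutiple :: "(nat \<Rightarrow> nat) \<Rightarrow> nat \<Rightarrow> nat \<Rightarrow> (nat \<Rightarrow> nat) \<Rightarrow> bool" where
  "permutiple \<sigma> k n a \<longleftrightarrow>
     1 < k \<and> \<sigma> permutes {0..n} \<and>
     canonical_digits a n \<and> canonical_digits (a \<circ> \<sigma>) n \<and>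
     cfrac a n = real k * cfrac (a \<circ> \<sigma>) n"

definition symmetric_permutiple :: "(nat \<Rightarrow> nat) \<Rightarrow> nat \<Rightarrow> nat \<Rightarrow> (nat \<Rightarrow> nat) \<Rightarrow> bool" where
  "symmetric_permutiple \<sigma> k n a \<longleftrightarrow>
     permutiple \<sigma> k n a \<and> (\<forall>j\<le>n. a j * a (n - j) = a (\<sigma> j) * a (\<sigma> (n - j)))"

definition continuant_preserving :: "(nat \<Rightarrow> nat) \<Rightarrow> nat \<Rightarrow> (nat \<Rightarrow> nat) \<Rightarrow> bool" where
  "continuant_preserving \<sigma> n a \<longleftrightarrow> continuant (n + 1) a = continuant (n + 1) (a \<circ> \<sigma>)"

end

theory Submission
  imports Defs
begin

text \<open>
  Write \<open>N/D\<close> and \<open>N'/D'\<close> for the two continued fractions as quotients of continuants.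
  Since \<open>N'\<close> and \<open>D'\<close> are coprime, \<open>N D' = k N' D\<close> forces \<open>N'\<close> to divide \<open>N\<close>. Symmetry makes
  \<open>N = a\<^sub>0a\<^sub>1a\<^sub>2a\<^sub>3 + a\<^sub>0a\<^sub>3 + 1 + (a\<^sub>0a\<^sub>1 + a\<^sub>2a\<^sub>3)\<close> and \<open>N'\<close> agree except for the bracket, and the bracket is
  at most \<open>a\<^sub>0a\<^sub>1a\<^sub>2a\<^sub>3 + 1 < N'\<close>. Hence \<open>0 < N < 2N'\<close>, and so \<open>N = N'\<close>.
\<close>

lemma continuant_4:
  "continuant 4 x = x 0 * x 1 * x 2 * x 3 + x 0 * x 1 + x 0 * x 3 + x 2 * x 3 + 1"
  by (simp add: eval_nat_numeral algebra_simps)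

text \<open>The denominator is the continuant of the tail \<open>x 1\<close>, \<open>x 2\<close>,
  \<open>x 3\<close>, written out.\<close>

lemma cfrac_3:
  assumes "\<forall>i\<le>3. 0 < x i"
  shows "cfrac x 3 = real (continuant 4 x) / real (x 1 * x 2 * x 3 + x 1 + x 3)"
proof -
  have pos: "0 < real (x 1)" "0 < real (x 2)" "0 < real (x 3)"
    using assms by auto
  have "cfrac x 3 = real (x 0) + 1 / (real (x 1) + 1 / (real (x 2) + 1 / real (x 3)))"
    by (simp add: eval_nat_numeral)
  also have "real (x 2) + 1 / real (x 3) = (real (x 2) * real (x 3) + 1) / real (x 3)"
    using pos by (simp add: field_simps)
  also have "real (x 1) + 1 / \<dots> =
      real (x 1 * x 2 * x 3 + x 1 + x 3) / (real (x 2) * real (x 3) + 1)"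
  proof -
    have "real (x 2) * real (x 3) + 1 \<noteq> 0"
      using pos by (simp add: add_nonneg_eq_0_iff)
    then show ?thesis
      by (simp add: field_simps)
  qed
  also have "real (x 0) + 1 / \<dots> = real (continuant 4 x) / real (x 1 * x 2 * x 3 + x 1 + x 3)"
  proof -
    have "real (x 1 * x 2 * x 3 + x 1 + x 3) \<noteq> 0"
      using pos by (subst of_nat_eq_0_iff) simp
    then show ?thesis
      unfolding continuant_4 by (simp add: field_simps)
  qed
  finally show ?thesis .
qed

text \<open>Euclid's algorithm: a common divisor of numerator and denominator passes to the
  successive remainders \<open>x 2 * x 3 + 1\<close>, \<open>x 3\<close> and finally 1.\<close>

lemma coprime_continuant_4:
  "coprime (continuant 4 x) (x 1 * x 2 * x 3 + x 1 + x 3)"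
proof (rule coprimeI)
  fix c
  let ?D = "x 1 * x 2 * x 3 + x 1 + x 3" and ?E = "x 2 * x 3 + 1"
  assume N: "c dvd continuant 4 x" and D: "c dvd ?D"
  have "continuant 4 x = x 0 * ?D + ?E"
    by (simp add: continuant_4 algebra_simps)
  with N D have E: "c dvd ?E"
    by (metis dvd_add_right_iff dvd_mult)
  have "?D = x 1 * ?E + x 3"
    by (simp add: algebra_simps)
  with D E have "c dvd x 3"
    by (metis dvd_add_right_iff dvd_mult)
  with E show "c dvd 1"
    by (metis dvd_add_right_iff dvd_mult)
qed

lemma permutiple_continuant_dvd:
  assumes "permutiple \<sigma> k 3 a"
  shows "continuant 4 (a \<circ> \<sigma>) dvd continuant 4 a"
proof -
  define D where "D x = x 1 * x 2 * x 3 + x 1 + x 3" for x :: "nat \<Rightarrow> nat"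
  have pos: "\<forall>i\<le>3. 0 < a i" "\<forall>i\<le>3. 0 < (a \<circ> \<sigma>) i"
    using assms unfolding permutiple_def canonical_digits_def by blast+
  then have "0 < D a" "0 < D (a \<circ> \<sigma>)"
    by (auto simp: D_def)
  moreover have "real (continuant 4 a) / real (D a) =
      real k * (real (continuant 4 (a \<circ> \<sigma>)) / real (D (a \<circ> \<sigma>)))"
    using assms cfrac_3 pos unfolding permutiple_def D_def by metis
  ultimately have "real (continuant 4 a) * real (D (a \<circ> \<sigma>)) =
      real (continuant 4 (a \<circ> \<sigma>)) * (real k * real (D a))"
    by (simp add: field_simps)
  then have "continuant 4 a * D (a \<circ> \<sigma>) = continuant 4 (a \<circ> \<sigma>) * (k * D a)"
    by (metis of_nat_eq_iff of_nat_mult)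
  then have "continuant 4 (a \<circ> \<sigma>) dvd continuant 4 a * D (a \<circ> \<sigma>)"
    by simp
  moreover have "coprime (continuant 4 (a \<circ> \<sigma>)) (D (a \<circ> \<sigma>))"
    unfolding D_def by (rule coprime_continuant_4)
  ultimately show ?thesis
    by (simp add: coprime_dvd_mult_left_iff)
qed

text \<open>This is (u - 1)(v - 1) \<ge> 0, expanded.\<close>

lemma add_le_Suc_mult:
  fixes u v :: nat
  assumes "0 < u" "0 < v"
  shows "u + v \<le> u * v + 1"
  using assms by (cases u; cases v) auto

theorem theorem15:
  fixes \<sigma> :: "nat \<Rightarrow> nat" and k :: nat and a :: "nat \<Rightarrow> nat"
  assumes "1 < k"
    and "\<sigma> permutes {0..3}"
    and "symmetric_permutiple \<sigma> k 3 a"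
  shows "continuant_preserving \<sigma> 3 a"
proof -
  let ?b = "a \<circ> \<sigma>"
  have perm: "permutiple \<sigma> k 3 a"
    and sym: "\<forall>j\<le>3. a j * a (3 - j) = ?b j * ?b (3 - j)"
    using assms(3) by (auto simp: symmetric_permutiple_def)
  have outer: "?b 0 * ?b 3 = a 0 * a 3" and inner: "?b 1 * ?b 2 = a 1 * a 2"
    using spec[OF sym, of 0] spec[OF sym, of 1] by auto
  \<comment> \<open>Pairing outer and inner digits expresses the full product by the two products
    that symmetry preserves.\<close>
  have "x 0 * x 1 * x 2 * x 3 = (x 0 * x 3) * (x 1 * x 2)" for x :: "nat \<Rightarrow> nat"
    by simp
  then have prod: "?b 0 * ?b 1 * ?b 2 * ?b 3 = a 0 * a 1 * a 2 * a 3"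
    by (simp only: outer inner)
  have pos: "0 < a i" if "i \<le> 3" for i
    using perm that unfolding permutiple_def canonical_digits_def by blast
  have "a 0 * a 1 + a 2 * a 3 \<le> (a 0 * a 1) * (a 2 * a 3) + 1"
    using pos by (intro add_le_Suc_mult) auto
  then have bound: "a 0 * a 1 + a 2 * a 3 \<le> a 0 * a 1 * a 2 * a 3 + 1"
    by (simp only: mult.assoc)
  have "0 < a 0 * a 3"
    using pos by simp
  \<comment> \<open>Strictness comes from \<open>a 0 * a 3\<close>, which occurs once on the left
    and twice on the right.\<close>
  with bound have "continuant 4 a < 2 * (a 0 * a 1 * a 2 * a 3 + a 0 * a 3 + 1)"
    unfolding continuant_4 mult_2 by presburger
  \<comment> \<open>The parenthesis is \<open>continuant 4 ?b\<close> without its terms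
    \<open>?b 0 * ?b 1\<close> and \<open>?b 2 * ?b 3\<close>.\<close>
  also have "\<dots> \<le> 2 * continuant 4 ?b"
    unfolding continuant_4 prod outer by simp
  finally have less: "continuant 4 a < 2 * continuant 4 ?b" .
  obtain m where m: "continuant 4 a = continuant 4 ?b * m"
    using permutiple_continuant_dvd[OF perm] by (elim dvdE)
  have "0 < continuant 4 a"
    by (simp add: continuant_4)
  \<comment> \<open>Positivity excludes \<open>m = 0\<close>, and \<open>less\<close> excludes
    \<open>m \<ge> 2\<close>.\<close>
  with m less have "m = 1"
    by (cases m) auto
  with m show ?thesis
    by (simp add: continuant_preserving_def)
qed

end
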